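(* Let $n$ and $m$ be positive integers, let $\epsilon$ be a primitive $n$-th root of unity, and define $$p_n(z;x_1,\dots,x_m)=\prod_{s_1,\dots,s_m=1}^n\bigl(\sqrt[n]{z}+\epsilon^{s_1}\sqrt[n]{x_1}+\dots+\epsilon^{s_m}\sqrt[n]{x_m}\bigr).$$ Then the following statements hold: (i) The polynomials $p_n(z;x_1,\dots,x_m)$ are symmetric in all variables. (ii) For all complex $z,x_1,\dots,x_m$, $$p_n(z^n;x_1,\dots,x_m)=\chi\bigl(F_n((-1)^{n+1}x_1)\boxplus\dots\boxplus F_n((-1)^{n+1}x_m);\,z\bigr).$$ (iii) The polynomials $p_n(z;x_1,\dots,x_m)$ are homogeneous polynomials in the variables $z,x_1,\dots,x_m$ of degree $n^{m-1}$ with integer coefficients.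
   Context: $F_n(a)$ denotes the $n\times n$ Frobenius companion matrix of the polynomial $t^n+a$: it has $1$'s on the subdiagonal, top-right entry $-a$, and all other entries $0$ (for $n=1$ it is the $1\times1$ matrix $(-a)$). For complex square matrices $A$ of order $p$ and $B$ of order $q$, the Kronecker sum is $A\boxplus B=A\otimes I_q+I_p\otimes B$ (an associative operation). $\chi(M;z)=\det(zI-M)$ is the characteristic polynomial. $\sqrt[n]{\cdot}$ is a fixed branch of the root, namely the one with $\sqrt[n]{1}=1$.
   Formalization: Symmetry in all variables including z is asserted only when m ≥ 2 or n is odd, because for m = 1 and n even p_n(z;x_1) = z − x_1 is not symmetric; symmetry in x_1,…,x_m is asserted for all n and m. *)

theory Defs
  imports
    "Jordan_Normal_Form.Char_Poly"
    "HOL-Library.Poly_Mapping"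
    "HOL-Library.FuncSet"
    "HOL-Combinatorics.Permutations"
begin

definition primitive_root_of_unity :: "nat \<Rightarrow> complex \<Rightarrow> bool" where
  "primitive_root_of_unity n \<epsilon> \<longleftrightarrow> \<epsilon> ^ n = 1 \<and> (\<forall>k. 0 < k \<and> k < n \<longrightarrow> \<epsilon> ^ k \<noteq> 1)"

text \<open>
  Branches of the n-th root are arbitrary total selections of an n-th root of every complex
  number, normalised at 1; no continuity is required, so every choice of branch cut is covered.
\<close>

definition nth_root_branch :: "nat \<Rightarrow> (complex \<Rightarrow> complex) \<Rightarrow> bool" where
  "nth_root_branch n r \<longleftrightarrow> (\<forall>w. r w ^ n = w) \<and> r 1 = 1"

text \<open>
  Only the values \<open>x 1, \<dots>, x m\<close> matter; the index 0 is reserved for the variable \<open>z\<close>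
  wherever all \<open>m + 1\<close> variables are treated on the same footing.
\<close>

definition p_poly ::
  "nat \<Rightarrow> nat \<Rightarrow> (complex \<Rightarrow> complex) \<Rightarrow> complex \<Rightarrow> complex \<Rightarrow> (nat \<Rightarrow> complex) \<Rightarrow> complex"
where
  "p_poly n m r \<epsilon> z x =
     (\<Prod>s \<in> {1..m} \<rightarrow>\<^sub>E {1..n}. r z + (\<Sum>i = 1..m. \<epsilon> ^ s i * r (x i)))"

definition frobenius :: "nat \<Rightarrow> complex \<Rightarrow> complex mat" where
  "frobenius n a = mat n n (\<lambda>(i, j).
     if i = j + 1 then 1 else if i = 0 \<and> j = n - 1 then - a else 0)"

definition kronecker_product :: "complex mat \<Rightarrow> complex mat \<Rightarrow> complex mat" where
  "kronecker_product A B =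
     mat (dim_row A * dim_row B) (dim_col A * dim_col B) (\<lambda>(i, j).
       A $$ (i div dim_row B, j div dim_col B) * B $$ (i mod dim_row B, j mod dim_col B))"

definition kronecker_sum :: "complex mat \<Rightarrow> complex mat \<Rightarrow> complex mat" (infixr \<open>\<boxplus>\<close> 65) where
  "A \<boxplus> B = kronecker_product A (1\<^sub>m (dim_row B)) + kronecker_product (1\<^sub>m (dim_row A)) B"

text \<open>
  The empty sum is the neutral element of \<open>\<boxplus>\<close>, the zero matrix of order 1; it never
  contributes to the sum of a nonempty list.
\<close>

fun kronecker_sum_list :: "complex mat list \<Rightarrow> complex mat" where
  "kronecker_sum_list [] = 0\<^sub>m 1 1"
| "kronecker_sum_list [A] = A"
| "kronecker_sum_list (A # B # As) = A \<boxplus> kronecker_sum_list (B # As)"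

text \<open>
  Multivariate integer polynomials are finitely supported maps from monomials to coefficients,
  and a monomial is a finitely supported map from variable indices to exponents.
\<close>

type_synonym int_mpoly = "(nat \<Rightarrow>\<^sub>0 nat) \<Rightarrow>\<^sub>0 int"

definition mpoly_eval :: "(nat \<Rightarrow> complex) \<Rightarrow> int_mpoly \<Rightarrow> complex" where
  "mpoly_eval v P = (\<Sum>\<mu> \<in> Poly_Mapping.keys P. of_int (Poly_Mapping.lookup P \<mu>) *
     (\<Prod>i \<in> Poly_Mapping.keys \<mu>. v i ^ Poly_Mapping.lookup \<mu> i))"

definition mpoly_in_vars :: "nat set \<Rightarrow> int_mpoly \<Rightarrow> bool" where
  "mpoly_in_vars V P \<longleftrightarrow> (\<forall>\<mu> \<in> Poly_Mapping.keys P. Poly_Mapping.keys \<mu> \<subseteq> V)"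

definition mpoly_homogeneous :: "nat \<Rightarrow> int_mpoly \<Rightarrow> bool" where
  "mpoly_homogeneous d P \<longleftrightarrow> (\<forall>\<mu> \<in> Poly_Mapping.keys P.
     (\<Sum>i \<in> Poly_Mapping.keys \<mu>. Poly_Mapping.lookup \<mu> i) = d)"

lemma nth_root_branch_principal:
  assumes "n > 0"
  shows "nth_root_branch n (\<lambda>w. if w = 0 then 0 else rcis (root n (cmod w)) (Arg w / n))"
proof -
  have "rcis (root n (cmod w)) (Arg w / n) ^ n = w" for w
  proof -
    have "rcis (root n (cmod w)) (Arg w / n) ^ n = rcis (cmod w) (Arg w)"
      using assms by (simp add: DeMoivre2 mult.commute real_root_pow_pos2)
    then show ?thesis by (simp add: rcis_cmod_Arg)
  qed
  moreover have "Arg 1 = 0"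
    by (rule cis_Arg_unique) (auto simp: sgn_eq)
  ultimately show ?thesis
    using assms by (auto simp: nth_root_branch_def)
qed

text \<open>
  For \<open>m = 1\<close> and even \<open>n\<close> the polynomial is \<open>z - x\<^sub>1\<close>, which is not invariant under exchanging
  \<open>z\<close> and \<open>x\<^sub>1\<close>. Symmetry in all variables including \<open>z\<close> therefore needs \<open>2 \<le> m\<close> or \<open>n\<close> odd.
\<close>

lemma p_poly_1_even_not_symmetric:
  assumes n: "even n" "n > 0" and \<epsilon>: "primitive_root_of_unity n \<epsilon>" and r: "nth_root_branch n r"
  shows "p_poly n 1 r \<epsilon> 1 (\<lambda>_. 0) = 1" and "p_poly n 1 r \<epsilon> 0 (\<lambda>_. 1) = -1"
proof -
  have p1: "p_poly n 1 r \<epsilon> z x = (\<Prod>s = 1..n. r z + \<epsilon> ^ s * r (x 1))" for z x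
    unfolding p_poly_def
    by (rule prod.reindex_bij_witness[of _ "\<lambda>s. restrict (\<lambda>_. s) {1}" "\<lambda>f. f 1"])
      (auto simp: PiE_def extensional_def restrict_def fun_eq_iff)
  have r0: "r 0 = 0" and r1: "r 1 = 1"
    using r n by (auto simp: nth_root_branch_def) (metis power_eq_0_iff)
  show "p_poly n 1 r \<epsilon> 1 (\<lambda>_. 0) = 1"
    by (simp add: p1[unfolded One_nat_def] r0 r1)
  obtain k where k: "n = 2 * k" using n by (auto elim: evenE)
  have "(\<epsilon> ^ k)\<^sup>2 = 1" "\<epsilon> ^ k \<noteq> 1"
    using \<epsilon> n k by (auto simp: primitive_root_of_unity_def power_mult[symmetric] mult.commute)
  then have half: "\<epsilon> ^ k = -1" by (simp add: power2_eq_1_iff)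
  have "(\<Prod>s = 1..n. \<epsilon> ^ s) = \<epsilon> ^ (\<Sum>s = 1..n. s)"
    by (simp add: power_sum)
  also have "(\<Sum>s = 1..n. s) = k * (n + 1)"
    using gauss_sum_from_Suc_0[where 'a = nat, of n] k by simp
  also have "\<epsilon> ^ (k * (n + 1)) = (-1) ^ (n + 1)"
    by (simp only: power_mult half)
  finally show "p_poly n 1 r \<epsilon> 0 (\<lambda>_. 1) = -1"
    using n by (simp add: p1[unfolded One_nat_def] r0 r1)
qed

end

(* Let U be the group of n-th roots of unity, so that p_n is the product over all w in U^m of
   (root of z) + sum of w_i (root of x_i).
   (ii) The eigenvalues of the i-th Frobenius matrix are -u (root of x_i) with u in U, and the
   eigenvalues of a Kronecker sum are the sums of eigenvalues: triangularise both summands.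
   (i) Exchanging z and x_k amounts to dividing the factor of w by w_k and reindexing; the product
   of w_k over all w is 1 if m > 1 or n is odd.
   (iii) By (ii), p_n is an integer polynomial in u = (root of z) and x_1, ..., x_m, because a
   determinant is one in its entries. It is multiplied by t^(n^m) under u -> t u, x_i -> t^n x_i, so
   only monomials with deg_u + n deg_x = n^m occur. In these n divides deg_u, and replacing u^n
   by z makes them homogeneous of degree n^(m-1). *)
theory Submission
  imports Defs "Jordan_Normal_Form.Schur_Decomposition"
begin

subsection \<open>Frobenius matrices\<close>

text \<open>As polynomials in z both sides are monic of degree n and vanish at the n points u * c,
  which are distinct when c is nonzero. For c = 0 these points coincide, but every factor is then
  z.\<close>

lemma prod_roots_unity:
  fixes z c :: complex
  assumes "n > 0"
  shows "(\<Prod>u | u ^ n = 1. z - u * c) = z ^ n - c ^ n"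
proof (cases "c = 0")
  case True
  then show ?thesis using assms by (simp add: card_roots_unity_eq)
next
  case False
  let ?U = "{u :: complex. u ^ n = 1}"
  have fin: "finite ?U" using assms by (intro finite_roots_unity) simp
  have card: "card ?U = n" using assms by (rule card_roots_unity_eq)
  define P where "P = Polynomial.monom 1 n - [:c ^ n:]"
  define R where "R = (\<Prod>u\<in>?U. [:- (u * c), 1:])"
  have "degree R = n"
    unfolding R_def by (subst degree_prod_eq_sum_degree) (auto simp: card)
  have "lead_coeff R = 1"
    unfolding R_def by (simp add: lead_coeff_prod)
  have "degree P \<le> n"
    unfolding P_def by (intro degree_diff_le degree_monom_le) auto
  have "P = R"
  proof (rule poly_eqI_degree_lead_coeff[where n = n and A = "(\<lambda>u. u * c) ` ?U"])
    show "coeff P n = coeff R n"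
      using \<open>lead_coeff R = 1\<close> \<open>degree R = n\<close> assms by (simp add: P_def coeff_pCons split: nat.split)
    show "n \<le> card ((\<lambda>u. u * c) ` ?U)"
      using False by (subst card_image) (auto simp: inj_on_def card)
    show "poly P x = poly R x" if x: "x \<in> (\<lambda>u. u * c) ` ?U" for x
    proof -
      have "poly P x = 0" using x by (auto simp: P_def poly_monom power_mult_distrib)
      moreover have "poly R x = 0"
        unfolding R_def poly_prod using x by (intro prod_zero[OF fin]) auto
      ultimately show ?thesis by simp
    qed
  qed (use \<open>degree R = n\<close> \<open>degree P \<le> n\<close> in auto)
  then have "poly P z = poly R z" by simp
  then show ?thesis by (simp add: P_def R_def poly_monom poly_prod)
qed

text \<open>Evaluation commutes with the determinant, which leaves a matrix with complex entries.
  Both the Laplace expansion below and the integrality of the coefficients start from this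
  form.\<close>

lemma poly_char_poly_eq_det:
  fixes A :: "complex mat"
  assumes A: "A \<in> carrier_mat n n"
  shows "poly (char_poly A) z = det (mat n n (\<lambda>(i, j). (if i = j then z else 0) - A $$ (i, j)))"
  unfolding char_poly_def
  by (rule poly_det_cong[of _ n]) (use A in \<open>auto simp: char_poly_matrix_def\<close>)

lemma frobenius_carrier [simp]: "frobenius n a \<in> carrier_mat n n"
  by (simp add: frobenius_def)

text \<open>Row 0 of zI - F has only the entries z in column 0 and a in the last column. The first
  minor is lower triangular with diagonal z; the second is upper triangular with diagonal -1, and
  its sign cancels the sign of the cofactor. For n = 1 the two entries fall together.\<close>

lemma poly_char_poly_frobenius:
  assumes "n > 0"
  shows "poly (char_poly (frobenius n a)) z = z ^ n + a"
proof -
  obtain k where n: "n = Suc k" using assms by (cases n) auto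
  define M where "M = mat n n (\<lambda>(i, j). (if i = j then z else 0) - frobenius n a $$ (i, j))"
  have M: "M \<in> carrier_mat n n" by (simp add: M_def)
  have poly_eq: "poly (char_poly (frobenius n a)) z = det M"
    unfolding M_def by (rule poly_char_poly_eq_det) simp
  show ?thesis
  proof (cases "k = 0")
    case True
    then show ?thesis unfolding poly_eq
      using n det_single[of M] M by (simp add: M_def frobenius_def)
  next
    case False
    have entry: "M $$ (0, j) = (if j = 0 then z else if j = k then a else 0)" if "j < n" for j
      using that False n by (auto simp: M_def frobenius_def)
    have "det M = (\<Sum>j<n. M $$ (0, j) * cofactor M 0 j)"
      by (rule laplace_expansion_row[OF M]) (use n in simp)
    also have "\<dots> = (\<Sum>j\<in>{0, k}. M $$ (0, j) * cofactor M 0 j)"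
      by (rule sum.mono_neutral_right) (use n entry in auto)
    also have "\<dots> = z * cofactor M 0 0 + a * cofactor M 0 k"
      using False n entry by simp
    also have "cofactor M 0 0 = z ^ k"
    proof -
      have "det (mat_delete M 0 0) = prod_list (diag_mat (mat_delete M 0 0))"
        by (rule det_lower_triangular[of k])
          (use n in \<open>auto simp: mat_delete_def M_def frobenius_def\<close>)
      also have "\<dots> = (\<Prod>i = 0..<k. z)"
        unfolding prod_list_diag_prod
        by (rule prod.cong) (use n in \<open>auto simp: mat_delete_def M_def frobenius_def\<close>)
      finally show ?thesis by (simp add: cofactor_def)
    qed
    also have "cofactor M 0 k = 1"
    proof -
      have "det (mat_delete M 0 k) = prod_list (diag_mat (mat_delete M 0 k))"
        by (rule det_upper_triangular[of _ k])
          (use n in \<open>auto simp: mat_delete_def M_def frobenius_def upper_triangular_def\<close>)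
      also have "\<dots> = (\<Prod>i = 0..<k. -1)"
        unfolding prod_list_diag_prod
        by (rule prod.cong) (use n in \<open>auto simp: mat_delete_def M_def frobenius_def\<close>)
      finally show ?thesis by (simp add: cofactor_def flip: power_add mult_2)
    qed
    finally show ?thesis unfolding poly_eq using n by simp
  qed
qed

text \<open>The sign gives (-1)^(n+1) * y^n = - (-y)^n for either parity of n, so the eigenvalues
  are -u * y and the linear factors become z + u * y, as in p_n. The double negation keeps the shape
  \<open>[:- f, 1:]\<close> used for Kronecker sums.\<close>

lemma char_poly_frobenius_roots:
  assumes "n > 0"
  shows "char_poly (frobenius n ((-1) ^ (n + 1) * y ^ n)) = (\<Prod>u | u ^ n = 1. [:- (- (u * y)), 1:])"
proof -
  have "poly (char_poly (frobenius n ((-1) ^ (n + 1) * y ^ n))) z =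
      poly (\<Prod>u | u ^ n = 1. [:- (- (u * y)), 1:]) z" for z
    using prod_roots_unity[OF assms, of z "- y"]
    by (simp add: poly_char_poly_frobenius[OF assms] poly_prod power_minus[of y] algebra_simps)
  then show ?thesis by (simp add: poly_eq_poly_eq_iff[symmetric] fun_eq_iff)
qed

subsection \<open>Spectrum of Kronecker sums\<close>

text \<open>A Kronecker index encodes a pair in base q; sums and products over such indices become
  double ones through this bijection.\<close>

lemma bij_betw_div_mod:
  "bij_betw (\<lambda>k. (k div q, k mod q)) {0..<p * q} ({0..<p} \<times> {0..<q :: nat})"
proof (rule bij_betw_byWitness[where f' = "\<lambda>(i, j). i * q + j"])
  show "(\<lambda>(i, j). i * q + j) ` ({0..<p} \<times> {0..<q}) \<subseteq> {0..<p * q}"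
  proof clarsimp
    fix i j assume "i < p" "j < q"
    then have "i * q + j < (i + 1) * q" by simp
    also have "\<dots> \<le> p * q" using \<open>i < p\<close> by (intro mult_right_mono) auto
    finally show "i * q + j < p * q" .
  qed
  show "(\<lambda>k. (k div q, k mod q)) ` {0..<p * q} \<subseteq> {0..<p} \<times> {0..<q}"
    by (cases "q = 0") (auto simp: less_mult_imp_div_less)
qed auto

lemma kronecker_product_carrier:
  assumes "A \<in> carrier_mat p p'" "B \<in> carrier_mat q q'"
  shows "kronecker_product A B \<in> carrier_mat (p * q) (p' * q')"
  using assms by (simp add: kronecker_product_def)

lemma kronecker_sum_carrier:
  assumes "A \<in> carrier_mat p p" "B \<in> carrier_mat q q"
  shows "A \<boxplus> B \<in> carrier_mat (p * q) (p * q)"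
  using assms by (auto simp: kronecker_sum_def kronecker_product_def)

lemma kronecker_sum_index:
  assumes A: "A \<in> carrier_mat p p" and B: "B \<in> carrier_mat q q" and ij: "i < p * q" "j < p * q"
  shows "(A \<boxplus> B) $$ (i, j) =
    (if i mod q = j mod q then A $$ (i div q, j div q) else 0) +
    (if i div q = j div q then B $$ (i mod q, j mod q) else 0)"
proof -
  have "q > 0" using ij by (cases q) auto
  then show ?thesis
    using assms by (auto simp: kronecker_sum_def kronecker_product_def less_mult_imp_div_less)
qed

text \<open>The mixed-product rule: after decoding the summation index into a pair, each entry
  factors into a product of two independent sums.\<close>

lemma kronecker_product_mult:
  assumes A: "A \<in> carrier_mat p p'" and B: "B \<in> carrier_mat q q'"
    and C: "C \<in> carrier_mat p' p''" and D: "D \<in> carrier_mat q' q''"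
  shows "kronecker_product A B * kronecker_product C D = kronecker_product (A * C) (B * D)"
proof (rule eq_matI)
  fix i j
  assume "i < dim_row (kronecker_product (A * C) (B * D))"
    and "j < dim_col (kronecker_product (A * C) (B * D))"
  then have i: "i < p * q" and j: "j < p'' * q''"
    using assms by (auto simp: kronecker_product_def)
  have q: "q > 0" "q'' > 0" using i j by (auto intro: Nat.gr0I)
  have i': "i div q < p" "i mod q < q" and j': "j div q'' < p''" "j mod q'' < q''"
    using i j q by (auto simp: less_mult_imp_div_less)
  have "(kronecker_product A B * kronecker_product C D) $$ (i, j) =
      (\<Sum>k = 0..<p' * q'. A $$ (i div q, k div q') * B $$ (i mod q, k mod q') *
        (C $$ (k div q', j div q'') * D $$ (k mod q', j mod q'')))"
    using assms i j by (auto simp: kronecker_product_def scalar_prod_def intro!: sum.cong)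
  also have "\<dots> = (\<Sum>(k, l)\<in>{0..<p'} \<times> {0..<q'}. A $$ (i div q, k) * B $$ (i mod q, l) *
        (C $$ (k, j div q'') * D $$ (l, j mod q'')))"
    using sum.reindex_bij_betw[OF bij_betw_div_mod[of q' p'], of "\<lambda>(k, l).
        A $$ (i div q, k) * B $$ (i mod q, l) * (C $$ (k, j div q'') * D $$ (l, j mod q''))"]
    by simp
  also have "\<dots> = (\<Sum>k = 0..<p'. A $$ (i div q, k) * C $$ (k, j div q'')) *
      (\<Sum>l = 0..<q'. B $$ (i mod q, l) * D $$ (l, j mod q''))"
    by (simp add: sum_product sum.cartesian_product ac_simps)
  also have "\<dots> = kronecker_product (A * C) (B * D) $$ (i, j)"
    using assms i j i' j' by (simp add: kronecker_product_def scalar_prod_def)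
  finally show "(kronecker_product A B * kronecker_product C D) $$ (i, j) =
    kronecker_product (A * C) (B * D) $$ (i, j)" .
qed (use assms in \<open>auto simp: kronecker_product_def\<close>)

lemma kronecker_product_one:
  "kronecker_product (1\<^sub>m p) (1\<^sub>m q) = 1\<^sub>m (p * q)"
proof (rule eq_matI)
  fix i j assume ij: "i < dim_row (1\<^sub>m (p * q) :: complex mat)" "j < dim_col (1\<^sub>m (p * q) :: complex mat)"
  then have "q > 0" by (auto intro: Nat.gr0I)
  moreover have "i = j" if "i div q = j div q" "i mod q = j mod q"
    using that by (metis div_mult_mod_eq)
  ultimately show "kronecker_product (1\<^sub>m p) (1\<^sub>m q) $$ (i, j) = 1\<^sub>m (p * q) $$ (i, j)"
    using ij by (auto simp: kronecker_product_def less_mult_imp_div_less)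
qed (auto simp: kronecker_product_def)

text \<open>By the mixed-product rule, conjugation with the Kronecker product of P and Q carries
  both terms of \<open>T \<boxplus> S\<close> to those of \<open>A \<boxplus> B\<close>
  simultaneously.\<close>

lemma similar_mat_kronecker_sum:
  assumes A: "A \<in> carrier_mat p p" and B: "B \<in> carrier_mat q q"
    and "similar_mat_wit A T P P'" and "similar_mat_wit B S Q Q'"
  shows "similar_mat (A \<boxplus> B) (T \<boxplus> S)"
proof -
  note a = similar_mat_witD2[OF A assms(3)] and b = similar_mat_witD2[OF B assms(4)]
  note car = a(5-7) b(5-7)
  let ?K = kronecker_product
  note mixed = kronecker_product_mult[where p = p and p' = p and p'' = p
      and q = q and q' = q and q'' = q]
  \<comment> \<open>The identities are written as conjugates, so that both terms acquire the same
    outer factors.\<close>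
  have id: "1\<^sub>m p = P * 1\<^sub>m p * P'" "1\<^sub>m q = Q * 1\<^sub>m q * Q'"
    using a b by (auto simp: right_mult_one_mat[of _ p p] right_mult_one_mat[of _ q q])
  have 1: "?K A (1\<^sub>m q) = ?K P Q * ?K T (1\<^sub>m q) * ?K P' Q'"
  proof -
    have "?K A (1\<^sub>m q) = ?K (P * T * P') (Q * 1\<^sub>m q * Q')" using a(3) id by metis
    also have "\<dots> = ?K P Q * ?K T (1\<^sub>m q) * ?K P' Q'"
      using car by (simp add: mixed)
    finally show ?thesis .
  qed
  have 2: "?K (1\<^sub>m p) B = ?K P Q * ?K (1\<^sub>m p) S * ?K P' Q'"
  proof -
    have "?K (1\<^sub>m p) B = ?K (P * 1\<^sub>m p * P') (Q * S * Q')" using b(3) id by metis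
    also have "\<dots> = ?K P Q * ?K (1\<^sub>m p) S * ?K P' Q'"
      using car by (simp add: mixed)
    finally show ?thesis .
  qed
  have carK: "?K P Q \<in> carrier_mat (p * q) (p * q)" "?K P' Q' \<in> carrier_mat (p * q) (p * q)"
    "?K T (1\<^sub>m q) \<in> carrier_mat (p * q) (p * q)" "?K (1\<^sub>m p) S \<in> carrier_mat (p * q) (p * q)"
    using car by (auto intro!: kronecker_product_carrier)
  have dims: "dim_row A = p" "dim_row B = q" "dim_row T = p" "dim_row S = q"
    using A B car by auto
  have "A \<boxplus> B = ?K P Q * (T \<boxplus> S) * ?K P' Q'"
    unfolding kronecker_sum_def dims 1 2
    using carK by (simp add: mult_add_distrib_mat[of _ "p * q" "p * q" _ "p * q"]
        add_mult_distrib_mat[of _ "p * q" "p * q" _ _ "p * q"])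
  moreover have "?K P Q * ?K P' Q' = 1\<^sub>m (p * q)" "?K P' Q' * ?K P Q = 1\<^sub>m (p * q)"
    using car a(1,2) b(1,2)
    by (simp_all add: mixed
        kronecker_product_one)
  ultimately show ?thesis
    using carK kronecker_sum_carrier[OF A B] kronecker_sum_carrier[OF car(1) car(4)]
    by (intro similar_matI[where P = "?K P Q" and Q = "?K P' Q'" and n = "p * q"]) auto
qed

text \<open>Indices are ordered lexicographically by quotient and remainder. Below the diagonal
  either the quotient drops, so that T contributes 0 and S is not involved, or the quotients agree
  and the remainder drops, so that S contributes 0 and the T term is absent.\<close>

lemma upper_triangular_kronecker_sum:
  assumes T: "T \<in> carrier_mat p p" "upper_triangular T" and S: "S \<in> carrier_mat q q" "upper_triangular S"
  shows "upper_triangular (T \<boxplus> S)"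
proof (rule upper_triangularI)
  fix i j assume ji: "j < i" and "i < dim_row (T \<boxplus> S)"
  then have i: "i < p * q" using kronecker_sum_carrier[OF T(1) S(1)] by auto
  then have q: "q > 0" by (auto intro: Nat.gr0I)
  have bd: "i div q < p" "i mod q < q" using i q by (auto simp: less_mult_imp_div_less)
  have "j div q \<le> i div q" using ji by (simp add: div_le_mono)
  then consider "j div q < i div q" | "j div q = i div q" "j mod q < i mod q"
    using ji by (metis div_mult_mod_eq le_neq_implies_less nat_add_left_cancel_less)
  then show "(T \<boxplus> S) $$ (i, j) = 0"
    using ji i T S bd by cases (auto simp: kronecker_sum_index[OF T(1) S(1)] upper_triangular_def)
qed

text \<open>After Schur triangularisation of both summands, the diagonal of
  \<open>T \<boxplus> S\<close> consists of all sums of a diagonal entry of T and one of S. Spectra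
  are indexed families, so multiplicities are kept even if f or g is not injective.\<close>

lemma char_poly_kronecker_sum:
  fixes f :: "'a \<Rightarrow> complex" and g :: "'b \<Rightarrow> complex"
  assumes A: "A \<in> carrier_mat p p" and B: "B \<in> carrier_mat q q"
    and fin: "finite I" "finite J"
    and cA: "char_poly A = (\<Prod>i\<in>I. [:- f i, 1:])" and cB: "char_poly B = (\<Prod>j\<in>J. [:- g j, 1:])"
  shows "char_poly (A \<boxplus> B) = (\<Prod>i\<in>I. \<Prod>j\<in>J. [:- (f i + g j), 1:])"
proof -
  obtain ks js where il: "set ks = I" "distinct ks" and jl: "set js = J" "distinct js"
    using fin finite_distinct_list by metis
  have cA': "char_poly A = (\<Prod>a\<leftarrow>map f ks. [:- a, 1:])"
    unfolding cA il(1)[symmetric] by (simp add: prod.distinct_set_conv_list[OF il(2)] o_def)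
  have cB': "char_poly B = (\<Prod>a\<leftarrow>map g js. [:- a, 1:])"
    unfolding cB jl(1)[symmetric] by (simp add: prod.distinct_set_conv_list[OF jl(2)] o_def)
  obtain T P P' where "schur_decomposition A (map f ks) = (T, P, P')"
    by (cases "schur_decomposition A (map f ks)")
  from schur_decomposition[OF A cA' this]
  have T: "similar_mat_wit A T P P'" "upper_triangular T" "diag_mat T = map f ks" by auto
  obtain S Q Q' where "schur_decomposition B (map g js) = (S, Q, Q')"
    by (cases "schur_decomposition B (map g js)")
  from schur_decomposition[OF B cB' this]
  have S: "similar_mat_wit B S Q Q'" "upper_triangular S" "diag_mat S = map g js" by auto
  have Tc: "T \<in> carrier_mat p p" and Sc: "S \<in> carrier_mat q q"
    using similar_mat_witD2[OF A T(1)] similar_mat_witD2[OF B S(1)] by auto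
  note TS = kronecker_sum_carrier[OF Tc Sc]
  have Td: "map (\<lambda>i. T $$ (i, i)) [0..<p] = map f ks" and Sd: "map (\<lambda>i. S $$ (i, i)) [0..<q] = map g js"
    using T(3) S(3) Tc Sc by (auto simp: diag_mat_def)
  \<comment> \<open>Stated for arbitrary h because it is applied twice at the end: to the inner
    product with the entry of T fixed, then to the outer one, whose factors are themselves products
    over J.\<close>
  have diag: "(\<Prod>l = 0..<p. h (T $$ (l, l))) = (\<Prod>i\<in>I. h (f i))" 
    "(\<Prod>l = 0..<q. h (S $$ (l, l))) = (\<Prod>j\<in>J. h (g j))" for h :: "complex \<Rightarrow> complex poly"
  proof -
    have "prod_list (map h (map (\<lambda>i. T $$ (i, i)) [0..<p])) = prod_list (map h (map f ks))" by (simp only: Td)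
    then show "(\<Prod>l = 0..<p. h (T $$ (l, l))) = (\<Prod>i\<in>I. h (f i))"
      by (simp add: o_def prod.distinct_set_conv_list[OF il(2), symmetric] il(1)
          prod.distinct_set_conv_list[OF distinct_upt, symmetric])
    have "prod_list (map h (map (\<lambda>i. S $$ (i, i)) [0..<q])) = prod_list (map h (map g js))" by (simp only: Sd)
    then show "(\<Prod>l = 0..<q. h (S $$ (l, l))) = (\<Prod>j\<in>J. h (g j))"
      by (simp add: o_def prod.distinct_set_conv_list[OF jl(2), symmetric] jl(1)
          prod.distinct_set_conv_list[OF distinct_upt, symmetric])
  qed
  have "char_poly (A \<boxplus> B) = char_poly (T \<boxplus> S)"
    by (rule char_poly_similar[OF similar_mat_kronecker_sum[OF A B T(1) S(1)]])
  also have "\<dots> = (\<Prod>a\<leftarrow>diag_mat (T \<boxplus> S). [:- a, 1:])"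
    by (rule char_poly_upper_triangular[OF TS upper_triangular_kronecker_sum[OF Tc T(2) Sc S(2)]])
  also have "\<dots> = (\<Prod>k = 0..<p * q. [:- (T $$ (k div q, k div q) + S $$ (k mod q, k mod q)), 1:])"
    using TS by (auto simp: diag_mat_def o_def prod.distinct_set_conv_list[OF distinct_upt, symmetric]
        kronecker_sum_index[OF Tc Sc] intro!: prod.cong)
  also have "\<dots> = (\<Prod>(k, l)\<in>{0..<p} \<times> {0..<q}. [:- (T $$ (k, k) + S $$ (l, l)), 1:])"
    using prod.reindex_bij_betw[OF bij_betw_div_mod[of q p],
        of "\<lambda>(k, l). [:- (T $$ (k, k) + S $$ (l, l)), 1:]"] by simp
  also have "\<dots> = (\<Prod>k = 0..<p. \<Prod>l = 0..<q. [:- (T $$ (k, k) + S $$ (l, l)), 1:])"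
    by (simp add: prod.cartesian_product)
  also have "\<dots> = (\<Prod>i\<in>I. \<Prod>j\<in>J. [:- (f i + g j), 1:])"
    by (simp only: diag(2)[of "\<lambda>a. [:- (_ + a), 1:]"] diag(1)[of "\<lambda>a. \<Prod>j\<in>J. [:- (a + g j), 1:]"])
  finally show ?thesis .
qed

lemma kronecker_sum_list_Cons:
  "As \<noteq> [] \<Longrightarrow> kronecker_sum_list (A # As) = A \<boxplus> kronecker_sum_list As"
  by (cases As) auto

text \<open>Splits off one coordinate of w. This drives the induction over Kronecker summands and
  the later evaluation of the product of a single coordinate.\<close>

lemma prod_PiE_insert:
  assumes "finite I" "k \<notin> I"
  shows "(\<Prod>w\<in>insert k I \<rightarrow>\<^sub>E U. h w) = (\<Prod>u\<in>U. \<Prod>w\<in>I \<rightarrow>\<^sub>E U. h (w(k := u)))"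
  unfolding PiE_insert_eq using assms
  by (subst prod.reindex[OF inj_combinator]) (auto simp: prod.cartesian_product case_prod_unfold)

text \<open>Each further summand adds one coordinate to w. Dimension and spectrum are proved
  together, since the inductive step needs the order of the remaining Kronecker sum. The induction
  starts at singletons, in accordance with \<open>kronecker_sum_list\<close>.\<close>

lemma char_poly_kronecker_sum_list:
  fixes f :: "'i \<Rightarrow> 'a \<Rightarrow> complex"
  assumes "\<And>i. A i \<in> carrier_mat q q" and "finite U"
    and "\<And>i. i \<in> set ks \<Longrightarrow> char_poly (A i) = (\<Prod>u\<in>U. [:- f i u, 1:])"
    and "ks \<noteq> []" "distinct ks"
  shows "kronecker_sum_list (map A ks) \<in> carrier_mat (q ^ length ks) (q ^ length ks) \<and>
    char_poly (kronecker_sum_list (map A ks)) =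
      (\<Prod>w\<in>set ks \<rightarrow>\<^sub>E U. [:- (\<Sum>i\<in>set ks. f i (w i)), 1:])"
  using assms(4,3,5)
proof (induction ks rule: list_nonempty_induct)
  case (single i)
  then show ?case
    using prod_PiE_insert[where I = "{}" and k = i and U = U and h = "\<lambda>w. [:- (\<Sum>i\<in>{i}. f i (w i)), 1:]"] assms(1) by simp
next
  case (cons i ks)
  let ?K = "kronecker_sum_list (map A ks)"
  have IH: "?K \<in> carrier_mat (q ^ length ks) (q ^ length ks)"
    "char_poly ?K = (\<Prod>w\<in>set ks \<rightarrow>\<^sub>E U. [:- (\<Sum>i\<in>set ks. f i (w i)), 1:])"
    using cons by auto
  have "char_poly (A i \<boxplus> ?K) =
      (\<Prod>u\<in>U. \<Prod>w\<in>set ks \<rightarrow>\<^sub>E U. [:- (f i u + (\<Sum>i\<in>set ks. f i (w i))), 1:])"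
    using cons.prems assms(1,2) IH by (intro char_poly_kronecker_sum) (auto intro!: finite_PiE)
  also have "\<dots> = (\<Prod>u\<in>U. \<Prod>w\<in>set ks \<rightarrow>\<^sub>E U.
      [:- (\<Sum>j\<in>insert i (set ks). f j ((w(i := u)) j)), 1:])"
  proof (intro prod.cong refl)
    fix u and w :: "'i \<Rightarrow> 'a"
    have "(\<Sum>j\<in>set ks. f j ((w(i := u)) j)) = (\<Sum>j\<in>set ks. f j (w j))"
      using cons.prems by (intro sum.cong) auto
    then show "[:- (f i u + (\<Sum>i\<in>set ks. f i (w i))), 1:] =
        [:- (\<Sum>j\<in>insert i (set ks). f j ((w(i := u)) j)), 1:]"
      using cons.prems by simp
  qed
  also have "\<dots> = (\<Prod>w\<in>insert i (set ks) \<rightarrow>\<^sub>E U. [:- (\<Sum>j\<in>insert i (set ks). f j (w j)), 1:])"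
    using cons.prems by (subst prod_PiE_insert) auto
  finally show ?case
    using cons.hyps kronecker_sum_carrier[OF assms(1) IH(1)] by (simp add: kronecker_sum_list_Cons)
qed

subsection \<open>Symmetry of the root products\<close>

definition frobenius_sum :: "nat \<Rightarrow> nat \<Rightarrow> (nat \<Rightarrow> complex) \<Rightarrow> complex mat" where
  "frobenius_sum n m x = kronecker_sum_list (map (\<lambda>i. frobenius n ((-1) ^ (n + 1) * x i)) [1..<m + 1])"

text \<open>The roots y i may be chosen freely for each i, independently of any branch; the scaling
  argument below exploits this.\<close>

lemma poly_char_poly_frobenius_sum:
  assumes "n > 0" "m > 0" and y: "\<And>i. i \<in> {1..m} \<Longrightarrow> y i ^ n = x i"
  shows "poly (char_poly (frobenius_sum n m x)) z =
    (\<Prod>w\<in>{1..m} \<rightarrow>\<^sub>E {u. u ^ n = 1}. z + (\<Sum>i = 1..m. w i * y i))"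
proof -
  let ?A = "\<lambda>i. frobenius n ((-1) ^ (n + 1) * x i)"
  have set_eq: "set [1..<m + 1] = {1..m}" by auto
  have fin: "finite {u :: complex. u ^ n = 1}" using assms by (intro finite_roots_unity) simp
  have "char_poly (?A i) = (\<Prod>u | u ^ n = 1. [:- (- (u * y i)), 1:])" if "i \<in> set [1..<m + 1]" for i
    using char_poly_frobenius_roots[OF \<open>n > 0\<close>, of "y i"] y[of i] that set_eq by auto
  then have "char_poly (frobenius_sum n m x) =
      (\<Prod>w\<in>set [1..<m + 1] \<rightarrow>\<^sub>E {u. u ^ n = 1}. [:- (\<Sum>i\<in>set [1..<m + 1]. - (w i * y i)), 1:])"
    unfolding frobenius_sum_def
    using char_poly_kronecker_sum_list[where A = ?A and q = n and ks = "[1..<m + 1]"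
        and U = "{u. u ^ n = 1}" and f = "\<lambda>i u. - (u * y i)"] fin \<open>m > 0\<close> by simp
  then show ?thesis
    unfolding set_eq by (simp add: poly_prod sum_negf add.commute)
qed

text \<open>If y i is a root of x i, then t * y i is one of x' i, so t comes out of each of the n^m
  factors. This yields both the weighted homogeneity behind (iii) and the independence of the root
  of z in (ii).\<close>

lemma poly_char_poly_frobenius_sum_scale:
  assumes "n > 0" "m > 0" and x': "\<And>i. i \<in> {1..m} \<Longrightarrow> x' i = t ^ n * x i"
  shows "poly (char_poly (frobenius_sum n m x')) (t * z) =
    t ^ n ^ m * poly (char_poly (frobenius_sum n m x)) z"
proof -
  obtain r where r: "nth_root_branch n r" using nth_root_branch_principal[OF \<open>n > 0\<close>] by blast
  let ?W = "{1..m} \<rightarrow>\<^sub>E {u :: complex. u ^ n = 1}"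
  have card: "card ?W = n ^ m" using \<open>n > 0\<close> by (simp add: card_funcsetE card_roots_unity_eq)
  have "poly (char_poly (frobenius_sum n m x')) (t * z) =
      (\<Prod>w\<in>?W. t * z + (\<Sum>i = 1..m. w i * (t * r (x i))))"
    by (rule poly_char_poly_frobenius_sum)
      (use assms r in \<open>auto simp: nth_root_branch_def power_mult_distrib\<close>)
  also have "\<dots> = (\<Prod>w\<in>?W. t * (z + (\<Sum>i = 1..m. w i * r (x i))))"
    by (simp add: sum_distrib_left distrib_left mult.left_commute)
  also have "\<dots> = t ^ n ^ m * (\<Prod>w\<in>?W. z + (\<Sum>i = 1..m. w i * r (x i)))"
    by (simp only: prod.distrib prod_constant card)
  also have "(\<Prod>w\<in>?W. z + (\<Sum>i = 1..m. w i * r (x i))) = poly (char_poly (frobenius_sum n m x)) z"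
    using assms r by (subst poly_char_poly_frobenius_sum) (auto simp: nth_root_branch_def)
  finally show ?thesis .
qed

section \<open>Passage from exponents to roots of unity\<close>

text \<open>Two equal powers would give a smaller exponent with power 1, so the n powers are
  distinct, and by cardinality they exhaust the n solutions of u^n = 1.\<close>

lemma bij_betw_primitive_root_powers:
  assumes "n > 0" "primitive_root_of_unity n \<epsilon>"
  shows "bij_betw (\<lambda>k. \<epsilon> ^ k) {1..n} {u. u ^ n = 1}"
proof -
  have \<epsilon>: "\<epsilon> ^ n = 1" "\<And>k. 0 < k \<Longrightarrow> k < n \<Longrightarrow> \<epsilon> ^ k \<noteq> 1"
    using assms by (auto simp: primitive_root_of_unity_def)
  have "\<epsilon> \<noteq> 0" using \<epsilon>(1) \<open>n > 0\<close> by (auto simp: zero_power)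
  have ne: "\<epsilon> ^ a \<noteq> \<epsilon> ^ b" if "a < b" "a \<in> {1..n}" "b \<in> {1..n}" for a b
  proof
    assume "\<epsilon> ^ a = \<epsilon> ^ b"
    then have "\<epsilon> ^ (b - a) = 1" using that \<open>\<epsilon> \<noteq> 0\<close> by (simp add: power_diff)
    moreover have "0 < b - a" "b - a < n" using that by auto
    ultimately show False using \<epsilon>(2) by blast
  qed
  have inj: "inj_on (\<lambda>k. \<epsilon> ^ k) {1..n}"
    by (rule linorder_inj_onI) (use ne in auto)
  have "(\<lambda>k. \<epsilon> ^ k) ` {1..n} = {u. u ^ n = 1}"
  proof (rule card_subset_eq)
    show "finite {u :: complex. u ^ n = 1}" using assms by (intro finite_roots_unity) simp
    have "(\<epsilon> ^ k) ^ n = 1" for k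
      using \<epsilon>(1) by (metis mult.commute power_mult power_one)
    then show "(\<lambda>k. \<epsilon> ^ k) ` {1..n} \<subseteq> {u. u ^ n = 1}" by auto
    show "card ((\<lambda>k. \<epsilon> ^ k) ` {1..n}) = card {u :: complex. u ^ n = 1}"
      using inj assms by (simp add: card_image card_roots_unity_eq)
  qed
  with inj show ?thesis by (simp add: bij_betw_def)
qed

lemma bij_betw_PiE:
  assumes "bij_betw g A B"
  shows "bij_betw (\<lambda>s. restrict (g \<circ> s) I) (I \<rightarrow>\<^sub>E A) (I \<rightarrow>\<^sub>E B)"
proof (rule bij_betw_byWitness[where f' = "\<lambda>w. restrict (inv_into A g \<circ> w) I"])
  show "\<forall>s\<in>I \<rightarrow>\<^sub>E A. restrict (inv_into A g \<circ> restrict (g \<circ> s) I) I = s"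
  proof (intro ballI ext)
    fix s i assume s: "s \<in> I \<rightarrow>\<^sub>E A"
    show "restrict (inv_into A g \<circ> restrict (g \<circ> s) I) I i = s i"
      using bij_betw_inv_into_left[OF assms] PiE_mem[OF s] PiE_arb[OF s] by (cases "i \<in> I") simp_all
  qed
  show "\<forall>w\<in>I \<rightarrow>\<^sub>E B. restrict (g \<circ> restrict (inv_into A g \<circ> w) I) I = w"
  proof (intro ballI ext)
    fix w i assume w: "w \<in> I \<rightarrow>\<^sub>E B"
    show "restrict (g \<circ> restrict (inv_into A g \<circ> w) I) I i = w i"
      using bij_betw_inv_into_right[OF assms] PiE_mem[OF w] PiE_arb[OF w] by (cases "i \<in> I") simp_all
  qed
  show "(\<lambda>s. restrict (g \<circ> s) I) ` (I \<rightarrow>\<^sub>E A) \<subseteq> I \<rightarrow>\<^sub>E B"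
    using bij_betw_apply[OF assms] by (auto dest: PiE_mem)
  show "(\<lambda>w. restrict (inv_into A g \<circ> w) I) ` (I \<rightarrow>\<^sub>E B) \<subseteq> I \<rightarrow>\<^sub>E A"
    using bij_betw_apply[OF bij_betw_inv_into[OF assms]] by (auto dest: PiE_mem)
qed

text \<open>Eliminates \<open>\<epsilon>\<close>: the index set becomes a power of the group of n-th
  roots of unity, where coordinates can be divided by one another.\<close>

lemma p_poly_roots_unity:
  assumes "n > 0" "primitive_root_of_unity n \<epsilon>"
  shows "p_poly n m r \<epsilon> z x =
    (\<Prod>w\<in>{1..m} \<rightarrow>\<^sub>E {u. u ^ n = 1}. r z + (\<Sum>i = 1..m. w i * r (x i)))"
proof -
  have "p_poly n m r \<epsilon> z x = (\<Prod>s\<in>{1..m} \<rightarrow>\<^sub>E {1..n}.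
      r z + (\<Sum>i = 1..m. restrict ((\<lambda>k. \<epsilon> ^ k) \<circ> s) {1..m} i * r (x i)))"
    by (simp add: p_poly_def)
  also have "\<dots> = (\<Prod>w\<in>{1..m} \<rightarrow>\<^sub>E {u. u ^ n = 1}. r z + (\<Sum>i = 1..m. w i * r (x i)))"
    by (rule prod.reindex_bij_betw[OF bij_betw_PiE[OF bij_betw_primitive_root_powers[OF assms]]])
  finally show ?thesis .
qed

lemma p_poly_eq_char_poly:
  assumes "n > 0" "m > 0" "primitive_root_of_unity n \<epsilon>" "nth_root_branch n r"
  shows "p_poly n m r \<epsilon> z x = poly (char_poly (frobenius_sum n m x)) (r z)"
  using assms
  by (subst poly_char_poly_frobenius_sum[where y = "\<lambda>i. r (x i)"])
    (auto simp: p_poly_roots_unity nth_root_branch_def)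

text \<open>The branch value of z^n may differ from z by a root of unity t. Scaling by t leaves
  every x i fixed, as t^n = 1, and multiplies the value by t^(n^m).\<close>

lemma p_poly_power_eq_char_poly:
  assumes "n > 0" "m > 0" "primitive_root_of_unity n \<epsilon>" "nth_root_branch n r"
  shows "p_poly n m r \<epsilon> (z ^ n) x = poly (char_poly (frobenius_sum n m x)) z"
proof -
  have r: "r (z ^ n) ^ n = z ^ n" using assms by (simp add: nth_root_branch_def)
  obtain t where t: "r (z ^ n) = t * z" "t ^ n = 1"
  proof (cases "z = 0")
    case True
    then show ?thesis using that[of 1] r \<open>n > 0\<close> by (simp add: zero_power)
  next
    case False
    then show ?thesis using that[of "r (z ^ n) / z"] r by (simp add: power_divide)
  qed
  \<comment> \<open>Since m > 0, the exponent n^m is a multiple of n.\<close>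
  have "t ^ n ^ m = 1"
    using t(2) \<open>m > 0\<close> by (cases m) (simp_all add: power_mult)
  then show ?thesis
    using poly_char_poly_frobenius_sum_scale[of n m x t x z] assms t
    by (simp add: p_poly_eq_char_poly)
qed

section \<open>Invariance under permutations of the variables\<close>

text \<open>Permuting the a i has the same effect as permuting the coordinates of w, which only
  reorders the factors.\<close>

lemma prod_PiE_permute:
  fixes a :: "'i \<Rightarrow> complex"
  assumes \<sigma>: "\<sigma> permutes I"
  shows "(\<Prod>w\<in>I \<rightarrow>\<^sub>E U. h (\<Sum>i\<in>I. w i * a (\<sigma> i))) = (\<Prod>w\<in>I \<rightarrow>\<^sub>E U. h (\<Sum>i\<in>I. w i * a i))"
proof (rule prod.reindex_bij_witness[of _ "\<lambda>w. restrict (w \<circ> \<sigma>) I" "\<lambda>w. restrict (w \<circ> inv_into UNIV \<sigma>) I"])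
  have in_I: "\<sigma> i \<in> I \<longleftrightarrow> i \<in> I" "inv_into UNIV \<sigma> i \<in> I \<longleftrightarrow> i \<in> I" for i
    using permutes_in_image[OF \<sigma>] permutes_in_image[OF permutes_inv[OF \<sigma>]] by auto
  fix w assume w: "w \<in> I \<rightarrow>\<^sub>E U"
  show "restrict (restrict (w \<circ> inv_into UNIV \<sigma>) I \<circ> \<sigma>) I = w"
    "restrict (restrict (w \<circ> \<sigma>) I \<circ> inv_into UNIV \<sigma>) I = w"
    using in_I PiE_arb[OF w] by (simp_all add: fun_eq_iff permutes_inverses[OF \<sigma>] restrict_def)
  show "restrict (w \<circ> inv_into UNIV \<sigma>) I \<in> I \<rightarrow>\<^sub>E U" "restrict (w \<circ> \<sigma>) I \<in> I \<rightarrow>\<^sub>E U"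
    using w in_I by auto
  have "(\<Sum>i\<in>I. restrict (w \<circ> inv_into UNIV \<sigma>) I i * a i) = (\<Sum>i\<in>I. restrict (w \<circ> inv_into UNIV \<sigma>) I (\<sigma> i) * a (\<sigma> i))"
    by (subst sum.permute[OF \<sigma>]) (simp add: o_def)
  also have "\<dots> = (\<Sum>i\<in>I. w i * a (\<sigma> i))"
    using in_I by (intro sum.cong) (auto simp: permutes_inverses[OF \<sigma>])
  finally show "h (\<Sum>i\<in>I. restrict (w \<circ> inv_into UNIV \<sigma>) I i * a i) = h (\<Sum>i\<in>I. w i * a (\<sigma> i))"
    by simp
qed

text \<open>Each root of unity occurs as w k exactly n^(card I - 1) times, and the product of all of
  them is 1 for odd n and -1 for even n. In the even case card I > 1 makes that exponent
  even.\<close>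

lemma prod_PiE_roots_unity_component:
  assumes "n > 0" "finite I" "k \<in> I" "2 \<le> card I \<or> odd n"
  shows "(\<Prod>w\<in>I \<rightarrow>\<^sub>E {u :: complex. u ^ n = 1}. w k) = 1"
proof -
  define J where "J = I - {k}"
  have J: "finite J" "k \<notin> J" "I = insert k J" using assms by (auto simp: J_def)
  have "(\<Prod>w\<in>I \<rightarrow>\<^sub>E {u :: complex. u ^ n = 1}. w k) = (\<Prod>u | u ^ n = 1. u) ^ n ^ card J"
    unfolding J(3) using J(1,2) \<open>n > 0\<close>
    by (simp add: prod_PiE_insert card_funcsetE card_roots_unity_eq prod_power_distrib)
  \<comment> \<open>The factorisation \<open>prod_roots_unity\<close> at z = 0 and c = -1.\<close>
  also have "(\<Prod>u | u ^ n = 1. u) = - ((-1) ^ n :: complex)"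
    using prod_roots_unity[OF \<open>n > 0\<close>, of 0 "-1"] \<open>n > 0\<close> by (simp add: zero_power)
  also have "(- ((-1) ^ n :: complex)) ^ n ^ card J = 1"
  proof (cases "odd n")
    case False
    then have "card J > 0" using assms(4) J by auto
    with False show ?thesis by simp
  qed simp
  finally show ?thesis .
qed

text \<open>Extracting w k from a factor exchanges the positions of b and c and changes w into
  \<open>\<phi> w\<close>. The extracted coordinates multiply to 1, and \<open>\<phi>\<close> is an
  involution, so it reindexes the remaining product.\<close>

lemma prod_PiE_roots_unity_swap:
  fixes a :: "'i \<Rightarrow> complex"
  assumes "n > 0" "finite I" "k \<in> I" "2 \<le> card I \<or> odd n"
  shows "(\<Prod>w\<in>I \<rightarrow>\<^sub>E {u. u ^ n = 1}. b + w k * c + (\<Sum>i\<in>I - {k}. w i * a i)) =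
    (\<Prod>w\<in>I \<rightarrow>\<^sub>E {u. u ^ n = 1}. c + w k * b + (\<Sum>i\<in>I - {k}. w i * a i))"
proof -
  let ?W = "I \<rightarrow>\<^sub>E {u :: complex. u ^ n = 1}"
  define \<phi> where "\<phi> w = restrict (\<lambda>i. if i = k then 1 / w k else w i / w k) I" for w :: "'i \<Rightarrow> complex"
  have pow: "w i ^ n = 1" if "w \<in> ?W" "i \<in> I" for w i
    using PiE_mem[OF that] by simp
  have nz: "w k \<noteq> 0" if "w \<in> ?W" for w
    using pow[OF that \<open>k \<in> I\<close>] \<open>n > 0\<close> by (auto simp: zero_power)
  have \<phi>_mem: "\<phi> w \<in> ?W" if "w \<in> ?W" for w
    using pow[OF that] \<open>k \<in> I\<close> by (auto simp: \<phi>_def power_divide)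
  have \<phi>_\<phi>: "\<phi> (\<phi> w) = w" if w: "w \<in> ?W" for w
  proof
    fix i
    show "\<phi> (\<phi> w) i = w i"
      using nz[OF w] \<open>k \<in> I\<close> PiE_arb[OF w, of i] by (cases "i \<in> I") (simp_all add: \<phi>_def)
  qed
  have "(\<Prod>w\<in>?W. b + w k * c + (\<Sum>i\<in>I - {k}. w i * a i)) =
      (\<Prod>w\<in>?W. w k * (c + \<phi> w k * b + (\<Sum>i\<in>I - {k}. \<phi> w i * a i)))"
  proof (rule prod.cong[OF refl])
    fix w assume w: "w \<in> ?W"
    have "w k * (\<Sum>i\<in>I - {k}. \<phi> w i * a i) = (\<Sum>i\<in>I - {k}. w i * a i)"
      unfolding sum_distrib_left using nz[OF w] by (intro sum.cong) (auto simp: \<phi>_def)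
    then show "b + w k * c + (\<Sum>i\<in>I - {k}. w i * a i) =
        w k * (c + \<phi> w k * b + (\<Sum>i\<in>I - {k}. \<phi> w i * a i))"
      using nz[OF w] \<open>k \<in> I\<close> by (simp add: distrib_left \<phi>_def)
  qed
  also have "\<dots> = (\<Prod>w\<in>?W. c + \<phi> w k * b + (\<Sum>i\<in>I - {k}. \<phi> w i * a i))"
    using prod_PiE_roots_unity_component[OF assms] by (simp add: prod.distrib)
  also have "\<dots> = (\<Prod>w\<in>?W. c + w k * b + (\<Sum>i\<in>I - {k}. w i * a i))"
    by (rule prod.reindex_bij_witness[of _ \<phi> \<phi>]) (simp_all add: \<phi>_mem \<phi>_\<phi>)
  finally show ?thesis .
qed

lemma p_poly_permute:
  assumes "n > 0" "primitive_root_of_unity n \<epsilon>" "\<sigma> permutes {1..m}"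
  shows "p_poly n m r \<epsilon> z (\<lambda>i. v (\<sigma> i)) = p_poly n m r \<epsilon> z v"
  using prod_PiE_permute[OF assms(3), of "\<lambda>s. r z + s" "\<lambda>i. r (v i)"]
  by (simp add: p_poly_roots_unity[OF assms(1,2)])

lemma p_poly_swap:
  assumes "n > 0" "primitive_root_of_unity n \<epsilon>" "2 \<le> m \<or> odd n" and k: "k \<in> {1..m}"
  shows "p_poly n m r \<epsilon> (v k) (\<lambda>i. v (transpose 0 k i)) = p_poly n m r \<epsilon> (v 0) v"
proof -
  have 1: "(\<Sum>i = 1..m. w i * r (v (transpose 0 k i))) =
      w k * r (v 0) + (\<Sum>i\<in>{1..m} - {k}. w i * r (v i))" for w
  proof -
    have "(\<Sum>i\<in>{1..m} - {k}. w i * r (v (transpose 0 k i))) = (\<Sum>i\<in>{1..m} - {k}. w i * r (v i))"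
      by (intro sum.cong) (auto simp: transpose_def)
    then show ?thesis using k by (subst sum.remove[of _ k]) auto
  qed
  have 2: "(\<Sum>i = 1..m. w i * r (v i)) = w k * r (v k) + (\<Sum>i\<in>{1..m} - {k}. w i * r (v i))" for w
    using k by (subst sum.remove[of _ k]) auto
  show ?thesis
    unfolding p_poly_roots_unity[OF assms(1,2)] 1 2
    using prod_PiE_roots_unity_swap[OF assms(1) _ k, of "r (v k)" "r (v 0)" "\<lambda>i. r (v i)"] assms(3)
    by (simp add: add.assoc)
qed

text \<open>Following \<open>\<sigma>\<close> by the transposition of 0 and
  \<open>\<sigma> 0\<close> gives a permutation that fixes 0 and is covered by
  \<open>p_poly_permute\<close>; the transposition itself is covered by
  \<open>p_poly_swap\<close>.\<close>

lemma p_poly_permute_all: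
  assumes "n > 0" "primitive_root_of_unity n \<epsilon>" "2 \<le> m \<or> odd n" and \<sigma>: "\<sigma> permutes {0..m}"
  shows "p_poly n m r \<epsilon> (v (\<sigma> 0)) (\<lambda>i. v (\<sigma> i)) = p_poly n m r \<epsilon> (v 0) v"
proof -
  let ?k = "\<sigma> 0"
  let ?t = "transpose 0 ?k"
  have k: "?k \<in> {0..m}" using permutes_in_image[OF \<sigma>, of 0] by simp
  have "?t \<circ> \<sigma> permutes {0..m}"
    by (intro permutes_compose \<sigma> permutes_swap_id) (use k in auto)
  then have "?t \<circ> \<sigma> permutes {1..m}"
    by (rule permutes_superset) (auto simp: not_less_eq_eq)
  from p_poly_permute[OF assms(1,2) this, of r "v ?k" "\<lambda>i. v (?t i)"]
  have "p_poly n m r \<epsilon> (v ?k) (\<lambda>i. v (\<sigma> i)) = p_poly n m r \<epsilon> (v ?k) (\<lambda>i. v (?t i))"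
    by simp
  also have "\<dots> = p_poly n m r \<epsilon> (v 0) v"
    using p_poly_swap[OF assms(1-3), of ?k] k by (cases "?k = 0") auto
  finally show ?thesis .
qed

subsection \<open>Integer polynomial functions\<close>

abbreviation monomial_eval :: "(nat \<Rightarrow> complex) \<Rightarrow> (nat \<Rightarrow>\<^sub>0 nat) \<Rightarrow> complex" where
  "monomial_eval v \<mu> \<equiv> \<Prod>i\<in>Poly_Mapping.keys \<mu>. v i ^ Poly_Mapping.lookup \<mu> i"

text \<open>Exponents outside the keys are 0, so monomials with different keys can be compared over
  a common index set.\<close>

lemma monomial_eval_superset:
  assumes "finite S" "Poly_Mapping.keys \<mu> \<subseteq> S"
  shows "monomial_eval v \<mu> = (\<Prod>i\<in>S. v i ^ Poly_Mapping.lookup \<mu> i)"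
  by (rule prod.mono_neutral_left) (use assms in \<open>auto simp: not_in_keys_iff_lookup_eq_zero\<close>)

lemma keys_add_nat:
  fixes \<mu> \<nu> :: "'a \<Rightarrow>\<^sub>0 nat"
  shows "Poly_Mapping.keys (\<mu> + \<nu>) = Poly_Mapping.keys \<mu> \<union> Poly_Mapping.keys \<nu>"
  by (auto simp: in_keys_iff lookup_add)

lemma monomial_eval_add:
  "monomial_eval v (\<mu> + \<nu>) = monomial_eval v \<mu> * monomial_eval v \<nu>"
proof -
  let ?S = "Poly_Mapping.keys \<mu> \<union> Poly_Mapping.keys \<nu>"
  have "monomial_eval v (\<mu> + \<nu>) =
      (\<Prod>i\<in>?S. v i ^ Poly_Mapping.lookup \<mu> i) * (\<Prod>i\<in>?S. v i ^ Poly_Mapping.lookup \<nu> i)"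
    by (simp add: keys_add_nat lookup_add power_add prod.distrib)
  then show ?thesis
    by (simp add: monomial_eval_superset[of ?S])
qed

lemma mpoly_eval_superset:
  assumes "finite S" "Poly_Mapping.keys P \<subseteq> S"
  shows "mpoly_eval v P = (\<Sum>\<mu>\<in>S. of_int (Poly_Mapping.lookup P \<mu>) * monomial_eval v \<mu>)"
  unfolding mpoly_eval_def
  by (rule sum.mono_neutral_left) (use assms in \<open>auto simp: not_in_keys_iff_lookup_eq_zero\<close>)

lemma mpoly_eval_zero [simp]: "mpoly_eval v 0 = 0"
  by (simp add: mpoly_eval_def)

lemma mpoly_eval_add: "mpoly_eval v (P + Q) = mpoly_eval v P + mpoly_eval v Q"
proof -
  let ?S = "Poly_Mapping.keys P \<union> Poly_Mapping.keys Q"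
  have "Poly_Mapping.keys (P + Q) \<subseteq> ?S" by (rule Poly_Mapping.keys_add)
  then show ?thesis
    by (simp add: mpoly_eval_superset[of ?S] lookup_add distrib_right sum.distrib)
qed

lemma mpoly_eval_sum: "mpoly_eval v (\<Sum>i\<in>I. f i) = (\<Sum>i\<in>I. mpoly_eval v (f i))"
  by (induction I rule: infinite_finite_induct) (simp_all add: mpoly_eval_add)

lemma mpoly_eval_single:
  "mpoly_eval v (Poly_Mapping.single \<mu> c) = of_int c * monomial_eval v \<mu>"
  by (simp add: mpoly_eval_def)

lemma poly_mapping_sum_single:
  "P = (\<Sum>k\<in>Poly_Mapping.keys P. Poly_Mapping.single k (Poly_Mapping.lookup P k))"
proof (rule poly_mapping_eqI)
  fix k
  show "Poly_Mapping.lookup P k =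
      Poly_Mapping.lookup (\<Sum>k\<in>Poly_Mapping.keys P. Poly_Mapping.single k (Poly_Mapping.lookup P k)) k"
    by (simp add: lookup_sum lookup_single when_def not_in_keys_iff_lookup_eq_zero)
qed

text \<open>Both factors are expanded into single terms; by bilinearity only products of monomials
  remain, and there exponents add.\<close>

lemma mpoly_eval_mult: "mpoly_eval v (P * Q) = mpoly_eval v P * mpoly_eval v Q"
proof -
  let ?s = "\<lambda>P \<mu>. Poly_Mapping.single \<mu> (Poly_Mapping.lookup P \<mu>) :: int_mpoly"
  have "P * Q = (\<Sum>\<mu>\<in>Poly_Mapping.keys P. \<Sum>\<nu>\<in>Poly_Mapping.keys Q. ?s P \<mu> * ?s Q \<nu>)"
    by (subst poly_mapping_sum_single[of P], subst poly_mapping_sum_single[of Q]) (rule sum_product)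
  then have "mpoly_eval v (P * Q) =
      (\<Sum>\<mu>\<in>Poly_Mapping.keys P. \<Sum>\<nu>\<in>Poly_Mapping.keys Q. mpoly_eval v (?s P \<mu> * ?s Q \<nu>))"
    by (simp only: mpoly_eval_sum)
  also have "\<dots> = (\<Sum>\<mu>\<in>Poly_Mapping.keys P. \<Sum>\<nu>\<in>Poly_Mapping.keys Q.
      (of_int (Poly_Mapping.lookup P \<mu>) * monomial_eval v \<mu>) *
      (of_int (Poly_Mapping.lookup Q \<nu>) * monomial_eval v \<nu>))"
    by (simp only: mult_single mpoly_eval_single monomial_eval_add of_int_mult mult_ac)
  also have "\<dots> = mpoly_eval v P * mpoly_eval v Q"
    unfolding mpoly_eval_def by (rule sum_product[symmetric])
  finally show ?thesis .
qed

text \<open>A mere existence predicate: closure under ring operations carries it through a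
  determinant without any explicit polynomial being written down.\<close>

definition int_poly_fun :: "nat set \<Rightarrow> ((nat \<Rightarrow> complex) \<Rightarrow> complex) \<Rightarrow> bool" where
  "int_poly_fun V f \<longleftrightarrow> (\<exists>P. mpoly_in_vars V P \<and> (\<forall>v. f v = mpoly_eval v P))"

lemma int_poly_fun_of_int: "int_poly_fun V (\<lambda>_. of_int c)"
  unfolding int_poly_fun_def
  by (rule exI[of _ "Poly_Mapping.single 0 c"]) (simp add: mpoly_in_vars_def mpoly_eval_single)

lemma int_poly_fun_0: "int_poly_fun V (\<lambda>_. 0)"
  and int_poly_fun_1: "int_poly_fun V (\<lambda>_. 1)"
  and int_poly_fun_neg_1: "int_poly_fun V (\<lambda>_. - 1)"
  using int_poly_fun_of_int[of V 0] int_poly_fun_of_int[of V 1] int_poly_fun_of_int[of V "- 1"]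
  by simp_all

lemma int_poly_fun_var: "i \<in> V \<Longrightarrow> int_poly_fun V (\<lambda>v. v i)"
  unfolding int_poly_fun_def
  by (rule exI[of _ "Poly_Mapping.single (Poly_Mapping.single i 1) 1"])
    (simp add: mpoly_in_vars_def mpoly_eval_single)

lemma int_poly_fun_add:
  assumes "int_poly_fun V f" "int_poly_fun V g"
  shows "int_poly_fun V (\<lambda>v. f v + g v)"
proof -
  from assms obtain P Q where PQ: "mpoly_in_vars V P" "mpoly_in_vars V Q"
    "\<forall>v. f v = mpoly_eval v P" "\<forall>v. g v = mpoly_eval v Q"
    unfolding int_poly_fun_def by blast
  have "mpoly_in_vars V (P + Q)"
    using PQ(1,2) Poly_Mapping.keys_add[of P Q] unfolding mpoly_in_vars_def by blast
  with PQ(3,4) show ?thesis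
    unfolding int_poly_fun_def by (intro exI[of _ "P + Q"]) (simp add: mpoly_eval_add)
qed

lemma int_poly_fun_mult:
  assumes "int_poly_fun V f" "int_poly_fun V g"
  shows "int_poly_fun V (\<lambda>v. f v * g v)"
proof -
  from assms obtain P Q where PQ: "mpoly_in_vars V P" "mpoly_in_vars V Q"
    "\<forall>v. f v = mpoly_eval v P" "\<forall>v. g v = mpoly_eval v Q"
    unfolding int_poly_fun_def by blast
  have "mpoly_in_vars V (P * Q)"
    unfolding mpoly_in_vars_def
  proof
    fix \<rho> assume "\<rho> \<in> Poly_Mapping.keys (P * Q)"
    then obtain \<mu> \<nu> where "\<rho> = \<mu> + \<nu>" "\<mu> \<in> Poly_Mapping.keys P" "\<nu> \<in> Poly_Mapping.keys Q"
      using keys_mult[of P Q] by blast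
    then show "Poly_Mapping.keys \<rho> \<subseteq> V"
      using PQ(1,2) by (simp add: mpoly_in_vars_def keys_add_nat)
  qed
  with PQ(3,4) show ?thesis
    unfolding int_poly_fun_def by (intro exI[of _ "P * Q"]) (simp add: mpoly_eval_mult)
qed

lemma int_poly_fun_diff:
  assumes "int_poly_fun V f" "int_poly_fun V g"
  shows "int_poly_fun V (\<lambda>v. f v - g v)"
  using int_poly_fun_add[OF assms(1) int_poly_fun_mult[OF int_poly_fun_neg_1 assms(2)]] by simp

lemma int_poly_fun_If:
  "int_poly_fun V f \<Longrightarrow> int_poly_fun V g \<Longrightarrow> int_poly_fun V (\<lambda>v. if b then f v else g v)"
  by (cases b) simp_all

lemma int_poly_fun_sum:
  "(\<And>i. i \<in> I \<Longrightarrow> int_poly_fun V (f i)) \<Longrightarrow> int_poly_fun V (\<lambda>v. \<Sum>i\<in>I. f i v)"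
  by (induction I rule: infinite_finite_induct) (auto intro: int_poly_fun_add int_poly_fun_0)

lemma int_poly_fun_prod:
  "(\<And>i. i \<in> I \<Longrightarrow> int_poly_fun V (f i)) \<Longrightarrow> int_poly_fun V (\<lambda>v. \<Prod>i\<in>I. f i v)"
  by (induction I rule: infinite_finite_induct) (auto intro: int_poly_fun_mult int_poly_fun_1)

section \<open>Matrices with integer polynomial entries\<close>

definition int_poly_mat :: "nat set \<Rightarrow> nat \<Rightarrow> ((nat \<Rightarrow> complex) \<Rightarrow> complex mat) \<Rightarrow> bool" where
  "int_poly_mat V d M \<longleftrightarrow> (\<forall>v. M v \<in> carrier_mat d d) \<and>
    (\<forall>i<d. \<forall>j<d. int_poly_fun V (\<lambda>v. M v $$ (i, j)))"

text \<open>The Leibniz formula expresses the determinant as an integer polynomial in the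
  entries.\<close>

lemma int_poly_fun_det:
  assumes "int_poly_mat V d M"
  shows "int_poly_fun V (\<lambda>v. det (M v))"
proof -
  have det_eq: "det (M v) = (\<Sum>p | p permutes {0..<d}. signof p * (\<Prod>i = 0..<d. M v $$ (i, p i)))" for v
    using assms by (intro det_def') (simp add: int_poly_mat_def)
  have summand: "int_poly_fun V (\<lambda>v. signof p * (\<Prod>i = 0..<d. M v $$ (i, p i)))"
    if p: "p permutes {0..<d}" for p
  proof (intro int_poly_fun_mult int_poly_fun_prod)
    show "int_poly_fun V (\<lambda>v. signof p)"
      by (cases p rule: sign_cases) (simp_all add: int_poly_fun_1 int_poly_fun_neg_1)
    show "int_poly_fun V (\<lambda>v. M v $$ (i, p i))" if "i \<in> {0..<d}" for i
      using assms that permutes_in_image[OF p, of i] by (simp add: int_poly_mat_def)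
  qed
  show ?thesis
    unfolding det_eq by (rule int_poly_fun_sum) (rule summand, simp)
qed

lemma int_poly_fun_char_poly:
  assumes M: "int_poly_mat V d M" and "k \<in> V"
  shows "int_poly_fun V (\<lambda>v. poly (char_poly (M v)) (v k))"
proof -
  let ?N = "\<lambda>v. mat d d (\<lambda>(i, j). (if i = j then v k else 0) - M v $$ (i, j))"
  have "int_poly_fun V (\<lambda>v. if i = j then v k else 0)" for i j :: nat
    by (intro int_poly_fun_If int_poly_fun_var int_poly_fun_0 \<open>k \<in> V\<close>)
  then have "int_poly_mat V d ?N"
    using M by (simp add: int_poly_mat_def int_poly_fun_diff)
  then have "int_poly_fun V (\<lambda>v. det (?N v))" by (rule int_poly_fun_det)
  moreover have "poly (char_poly (M v)) (v k) = det (?N v)" for v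
    using M by (intro poly_char_poly_eq_det) (simp add: int_poly_mat_def)
  ultimately show ?thesis by simp
qed

lemma int_poly_mat_kronecker_sum:
  assumes A: "int_poly_mat V p A" and B: "int_poly_mat V q B"
  shows "int_poly_mat V (p * q) (\<lambda>v. A v \<boxplus> B v)"
  unfolding int_poly_mat_def
proof (intro conjI allI impI)
  have car: "A v \<in> carrier_mat p p" "B v \<in> carrier_mat q q" for v
    using A B by (auto simp: int_poly_mat_def)
  show "A v \<boxplus> B v \<in> carrier_mat (p * q) (p * q)" for v
    by (rule kronecker_sum_carrier[OF car])
  fix i j assume ij: "i < p * q" "j < p * q"
  then have "q > 0" by (auto intro: Nat.gr0I)
  then have bd: "i div q < p" "i mod q < q" "j div q < p" "j mod q < q"
    using ij by (auto simp: less_mult_imp_div_less)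
  have "int_poly_fun V (\<lambda>v. if i mod q = j mod q then A v $$ (i div q, j div q) else 0)"
    "int_poly_fun V (\<lambda>v. if i div q = j div q then B v $$ (i mod q, j mod q) else 0)"
    using A B bd by (auto simp: int_poly_mat_def intro!: int_poly_fun_If int_poly_fun_0)
  then show "int_poly_fun V (\<lambda>v. (A v \<boxplus> B v) $$ (i, j))"
    unfolding kronecker_sum_index[OF car ij] by (rule int_poly_fun_add)
qed

lemma int_poly_mat_kronecker_sum_list:
  assumes "ks \<noteq> []" "\<And>i. i \<in> set ks \<Longrightarrow> int_poly_mat V q (A i)"
  shows "int_poly_mat V (q ^ length ks) (\<lambda>v. kronecker_sum_list (map (\<lambda>i. A i v) ks))"
  using assms
  by (induction ks rule: list_nonempty_induct)
    (simp_all add: kronecker_sum_list_Cons int_poly_mat_kronecker_sum)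

lemma int_poly_mat_frobenius:
  assumes "int_poly_fun V f"
  shows "int_poly_mat V n (\<lambda>v. frobenius n (f v))"
proof -
  have "int_poly_fun V (\<lambda>v. - f v)"
    using int_poly_fun_diff[OF int_poly_fun_0 assms] by simp
  then show ?thesis
    by (auto simp: int_poly_mat_def frobenius_def intro!: int_poly_fun_If int_poly_fun_0 int_poly_fun_1)
qed

text \<open>The spectral parameter is treated as variable 0, beside the entries x_1, ..., x_m. At
  this stage variable 0 stands for the root of z, not for z.\<close>

lemma int_poly_fun_char_poly_frobenius_sum:
  assumes "m > 0"
  shows "int_poly_fun {0..m} (\<lambda>v. poly (char_poly (frobenius_sum n m v)) (v 0))"
proof (rule int_poly_fun_char_poly)
  have sgn: "int_poly_fun V (\<lambda>_. (-1) ^ (n + 1))" for V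
    using int_poly_fun_of_int[of V "(-1) ^ (n + 1)"] by simp
  show "int_poly_mat {0..m} (n ^ length [1..<m + 1]) (frobenius_sum n m)"
    unfolding frobenius_sum_def using \<open>m > 0\<close>
    by (intro int_poly_mat_kronecker_sum_list int_poly_mat_frobenius int_poly_fun_mult sgn
        int_poly_fun_var) auto
qed simp

section \<open>From weighted to ordinary homogeneity\<close>

text \<open>For fixed v, both sides of the scaling law are polynomials in t, and the coefficients of
  t^N are compared. The conclusion concerns values: discarding all monomials of another weight does
  not change the function.\<close>

lemma mpoly_eval_weighted_homogeneous:
  fixes a :: "nat \<Rightarrow> nat"
  assumes "\<And>t v. mpoly_eval (\<lambda>i. t ^ a i * v i) P = t ^ N * mpoly_eval v P"
  defines "weight \<mu> \<equiv> \<Sum>i\<in>Poly_Mapping.keys \<mu>. a i * Poly_Mapping.lookup \<mu> i"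
  shows "mpoly_eval v P = (\<Sum>\<mu> | \<mu> \<in> Poly_Mapping.keys P \<and> weight \<mu> = N.
    of_int (Poly_Mapping.lookup P \<mu>) * monomial_eval v \<mu>)"
proof -
  define c where "c \<mu> = of_int (Poly_Mapping.lookup P \<mu>) * monomial_eval v \<mu>" for \<mu>
  let ?q = "\<Sum>\<mu>\<in>Poly_Mapping.keys P. Polynomial.monom (c \<mu>) (weight \<mu>)"
  have "poly ?q t = poly (Polynomial.monom (mpoly_eval v P) N) t" for t
  proof -
    have "monomial_eval (\<lambda>i. t ^ a i * v i) \<mu> = t ^ weight \<mu> * monomial_eval v \<mu>" for \<mu>
      by (simp add: weight_def power_mult_distrib prod.distrib power_sum power_mult)
    then have "mpoly_eval (\<lambda>i. t ^ a i * v i) P = poly ?q t"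
      by (simp add: mpoly_eval_def poly_sum poly_monom c_def mult_ac)
    then show ?thesis using assms(1)[of t v] by (simp add: poly_monom mult.commute)
  qed
  then have "?q = Polynomial.monom (mpoly_eval v P) N"
    by (simp add: poly_eq_poly_eq_iff[symmetric] fun_eq_iff)
  then have "mpoly_eval v P = poly.coeff ?q N" by simp
  also have "\<dots> = (\<Sum>\<mu>\<in>Poly_Mapping.keys P. if weight \<mu> = N then c \<mu> else 0)"
    by (simp add: coeff_sum)
  also have "\<dots> = (\<Sum>\<mu> | \<mu> \<in> Poly_Mapping.keys P \<and> weight \<mu> = N. c \<mu>)"
    by (simp add: sum.inter_filter)
  finally show ?thesis by (simp add: c_def)
qed

lemma p_poly_int_mpoly:
  assumes "n > 0" "m > 0" "primitive_root_of_unity n \<epsilon>" "nth_root_branch n r"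
  shows "\<exists>P. mpoly_in_vars {0..m} P \<and> mpoly_homogeneous (n ^ (m - 1)) P \<and>
    (\<forall>v. p_poly n m r \<epsilon> (v 0) v = mpoly_eval v P)"
proof -
  let ?F = "\<lambda>v. poly (char_poly (frobenius_sum n m v)) (v 0)"
  obtain P where P: "mpoly_in_vars {0..m} P" "\<And>v. ?F v = mpoly_eval v P"
    using int_poly_fun_char_poly_frobenius_sum[OF \<open>m > 0\<close>, of n] unfolding int_poly_fun_def by blast
  \<comment> \<open>Variable 0 is an n-th root of z, so it has weight 1 while each x_i has weight
    n.\<close>
  define a where "a i = (if i = 0 then 1 else n)" for i :: nat
  define weight where "weight \<mu> = (\<Sum>i\<in>Poly_Mapping.keys \<mu>. a i * Poly_Mapping.lookup \<mu> i)" for \<mu>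
  define K where "K = {\<mu> \<in> Poly_Mapping.keys P. weight \<mu> = n ^ m}"
  have "?F (\<lambda>i. t ^ a i * v i) = t ^ n ^ m * ?F v" for t v
    using poly_char_poly_frobenius_sum_scale[OF assms(1,2), of "\<lambda>i. t ^ a i * v i" t v "v 0"]
    by (simp add: a_def)
  then have "mpoly_eval (\<lambda>i. t ^ a i * v i) P = t ^ n ^ m * mpoly_eval v P" for t v
    by (simp only: P(2)[symmetric])
  from mpoly_eval_weighted_homogeneous[OF this]
  have evalP: "mpoly_eval v P = (\<Sum>\<mu>\<in>K. of_int (Poly_Mapping.lookup P \<mu>) * monomial_eval v \<mu>)" for v
    by (simp add: K_def weight_def)
  define rest where "rest \<mu> = (\<Sum>i\<in>Poly_Mapping.keys \<mu> - {0}. Poly_Mapping.lookup \<mu> i)" for \<mu> :: "nat \<Rightarrow>\<^sub>0 nat"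
  have weight: "weight \<mu> = Poly_Mapping.lookup \<mu> 0 + n * rest \<mu>" for \<mu>
  proof -
    have "weight \<mu> = (\<Sum>i\<in>insert 0 (Poly_Mapping.keys \<mu>). a i * Poly_Mapping.lookup \<mu> i)"
      unfolding weight_def
      by (rule sum.mono_neutral_left) (auto simp: not_in_keys_iff_lookup_eq_zero)
    also have "\<dots> = Poly_Mapping.lookup \<mu> 0 + (\<Sum>i\<in>Poly_Mapping.keys \<mu> - {0}. a i * Poly_Mapping.lookup \<mu> i)"
      by (subst sum.insert_remove) (auto simp: a_def)
    also have "(\<Sum>i\<in>Poly_Mapping.keys \<mu> - {0}. a i * Poly_Mapping.lookup \<mu> i) = n * rest \<mu>"
      unfolding rest_def sum_distrib_left by (intro sum.cong) (auto simp: a_def)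
    finally show ?thesis .
  qed
  have n_pow: "n ^ m = n * n ^ (m - 1)" using \<open>m > 0\<close> by (cases m) auto
  \<comment> \<open>Modulo n the weight is the exponent of variable 0, and n^m is divisible by n
    because m > 0.\<close>
  have dvd: "n dvd Poly_Mapping.lookup \<mu> 0" if "\<mu> \<in> K" for \<mu>
  proof -
    have "n dvd Poly_Mapping.lookup \<mu> 0 + n * rest \<mu>"
      using that weight[of \<mu>] n_pow by (simp add: K_def)
    then show ?thesis by (simp add: dvd_add_left_iff)
  qed
  \<comment> \<open>Replaces the n-th power of variable 0 by variable 0 itself, that is, passes from
    the root of z to z.\<close>
  define shift where "shift \<mu> = Poly_Mapping.update 0 (Poly_Mapping.lookup \<mu> 0 div n) \<mu>" for \<mu> :: "nat \<Rightarrow>\<^sub>0 nat"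
  have lookup_shift: "Poly_Mapping.lookup (shift \<mu>) i =
      (if i = 0 then Poly_Mapping.lookup \<mu> 0 div n else Poly_Mapping.lookup \<mu> i)" for \<mu> i
    by (simp add: shift_def lookup_update)
  have keys_shift: "Poly_Mapping.keys (shift \<mu>) \<subseteq> insert 0 (Poly_Mapping.keys \<mu>)" for \<mu>
    by (auto simp: in_keys_iff lookup_shift split: if_splits)
  define P' where "P' = (\<Sum>\<mu>\<in>K. Poly_Mapping.single (shift \<mu>) (Poly_Mapping.lookup P \<mu>))"
  have keys_P': "\<exists>\<mu>\<in>K. \<nu> = shift \<mu>" if "\<nu> \<in> Poly_Mapping.keys P'" for \<nu>
    using that keys_sum[of "\<lambda>\<mu>. Poly_Mapping.single (shift \<mu>) (Poly_Mapping.lookup P \<mu>)" K]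
    unfolding P'_def by (force split: if_splits)
  have "mpoly_in_vars {0..m} P'"
    unfolding mpoly_in_vars_def
  proof
    fix \<nu> assume "\<nu> \<in> Poly_Mapping.keys P'"
    then obtain \<mu> where "\<mu> \<in> K" "\<nu> = shift \<mu>" using keys_P' by blast
    moreover have "Poly_Mapping.keys \<mu> \<subseteq> {0..m}"
      using P(1) \<open>\<mu> \<in> K\<close> by (simp add: K_def mpoly_in_vars_def)
    ultimately show "Poly_Mapping.keys \<nu> \<subseteq> {0..m}"
      using keys_shift[of \<mu>] by auto
  qed
  moreover have "mpoly_homogeneous (n ^ (m - 1)) P'"
    unfolding mpoly_homogeneous_def
  proof
    fix \<nu> assume "\<nu> \<in> Poly_Mapping.keys P'"
    then obtain \<mu> where \<mu>: "\<mu> \<in> K" "\<nu> = shift \<mu>" using keys_P' by blast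
    have "(\<Sum>i\<in>Poly_Mapping.keys \<nu>. Poly_Mapping.lookup \<nu> i) =
        (\<Sum>i\<in>insert 0 (Poly_Mapping.keys \<mu>). Poly_Mapping.lookup \<nu> i)"
      by (rule sum.mono_neutral_left) (use keys_shift[of \<mu>] \<mu> in \<open>auto simp: not_in_keys_iff_lookup_eq_zero\<close>)
    also have "\<dots> = Poly_Mapping.lookup \<mu> 0 div n + rest \<mu>"
      unfolding rest_def \<mu>(2) by (subst sum.insert_remove) (auto simp: lookup_shift)
    \<comment> \<open>Since n divides the old exponent of variable 0, n times the new degree is
      exactly the old weight n^m; cancelling n leaves n^(m-1).\<close>
    finally have "n * (\<Sum>i\<in>Poly_Mapping.keys \<nu>. Poly_Mapping.lookup \<nu> i) = weight \<mu>"
      using dvd[OF \<mu>(1)] by (simp add: weight distrib_left)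
    also have "\<dots> = n * n ^ (m - 1)" using \<mu>(1) n_pow by (simp add: K_def)
    finally show "(\<Sum>i\<in>Poly_Mapping.keys \<nu>. Poly_Mapping.lookup \<nu> i) = n ^ (m - 1)"
      using \<open>n > 0\<close> by simp
  qed
  moreover have "p_poly n m r \<epsilon> (v 0) v = mpoly_eval v P'" for v
  proof -
    \<comment> \<open>P takes the root of z in position 0, whereas P' takes z.\<close>
    let ?u = "v(0 := r (v 0))"
    have "monomial_eval ?u \<mu> = monomial_eval v (shift \<mu>)" if \<mu>: "\<mu> \<in> K" for \<mu>
    proof -
      let ?S = "insert 0 (Poly_Mapping.keys \<mu>)"
      obtain e where e: "Poly_Mapping.lookup \<mu> 0 = n * e" using dvd[OF \<mu>] by blast
      have "r (v 0) ^ n = v 0" using assms(4) by (simp add: nth_root_branch_def)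
      then have "?u i ^ Poly_Mapping.lookup \<mu> i = v i ^ Poly_Mapping.lookup (shift \<mu>) i" for i
        using e \<open>n > 0\<close> by (simp add: lookup_shift power_mult)
      moreover have "monomial_eval ?u \<mu> = (\<Prod>i\<in>?S. ?u i ^ Poly_Mapping.lookup \<mu> i)"
        by (rule monomial_eval_superset) auto
      moreover have "monomial_eval v (shift \<mu>) = (\<Prod>i\<in>?S. v i ^ Poly_Mapping.lookup (shift \<mu>) i)"
        by (rule monomial_eval_superset) (use keys_shift in auto)
      ultimately show ?thesis by (simp only:)
    qed
    then have "mpoly_eval ?u P = mpoly_eval v P'"
      unfolding evalP P'_def mpoly_eval_sum mpoly_eval_single by (intro sum.cong) auto
    moreover have "p_poly n m r \<epsilon> (v 0) v = ?F ?u"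
    proof -
      \<comment> \<open>The matrix reads only the positions 1 to m, so overwriting position 0 does
        not affect it.\<close>
      have "frobenius_sum n m ?u = frobenius_sum n m v"
        unfolding frobenius_sum_def by (intro arg_cong[where f = kronecker_sum_list] map_cong) auto
      then show ?thesis by (simp add: p_poly_eq_char_poly[OF assms])
    qed
    ultimately show ?thesis using P(2)[of ?u] by (simp only:)
  qed
  ultimately show ?thesis by blast
qed

theorem theorem3:
  fixes n m :: nat and \<epsilon> :: complex and r :: "complex \<Rightarrow> complex"
  assumes "n > 0" and "m > 0"
    and "primitive_root_of_unity n \<epsilon>"
    and "nth_root_branch n r"
  shows "(\<forall>\<sigma> v. \<sigma> permutes {1..m} \<longrightarrow>
            p_poly n m r \<epsilon> (v 0) (\<lambda>i. v (\<sigma> i)) = p_poly n m r \<epsilon> (v 0) v)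
       \<and> (2 \<le> m \<or> odd n \<longrightarrow>
            (\<forall>\<sigma> v. \<sigma> permutes {0..m} \<longrightarrow>
               p_poly n m r \<epsilon> (v (\<sigma> 0)) (\<lambda>i. v (\<sigma> i)) = p_poly n m r \<epsilon> (v 0) v))
       \<and> (\<forall>z x. p_poly n m r \<epsilon> (z ^ n) x =
            poly (char_poly (kronecker_sum_list
              (map (\<lambda>i. frobenius n ((-1) ^ (n + 1) * x i)) [1..<m + 1]))) z)
       \<and> (\<exists>P :: int_mpoly. mpoly_in_vars {0..m} P \<and> mpoly_homogeneous (n ^ (m - 1)) P
            \<and> (\<forall>v. p_poly n m r \<epsilon> (v 0) v = mpoly_eval v P))"
  using p_poly_permute[OF assms(1,3)] p_poly_permute_all[OF assms(1,3)]
    p_poly_power_eq_char_poly[OF assms, unfolded frobenius_sum_def] p_poly_int_mpoly[OF assms]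
  by (intro conjI allI impI) auto

end
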